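(* Let $f\in L^2(\Omega)$, let $\hat u\in\mathcal D(L)$ be the exact solution of $Lu=f$, and let $\omega>0$. Let $u^h_{ts}$ and $u^h_{ss}$ in $\mathcal U^h$ be the solutions of the two-stage and the single-stage method (with weight $\omega$), respectively. If either $u^h_\diamond=u^h_{ss}$ and $s=(\omega+1)/\omega$, or $u^h_\diamond=u^h_{ts}$ and $s=1$, then $$\|u^h_\diamond-\hat u\|\le s\inf_{v^h\in\mathcal U^h}\|v^h-\hat u\|+(s+1)\inf_{w\in\mathcal Z^{\mathfrak h}}\|L^*w-\hat u\| .$$
   Context: $\Omega\subset\mathbb R^d$ is a domain; $L^2(\Omega)$ (real-valued) has norm $\|\cdot\|$ and inner product $\langle\cdot,\cdot\rangle$. $L$ is a linear first-order differential operator, regarded as a closed, densely defined unbounded linear operator in $L^2(\Omega)$ with domain $\mathcal D(L)$ (the functions $u\in L^2(\Omega)$ with $Lu\in L^2(\Omega)$ satisfying given homogeneous boundary conditions). $L^*$ with domain $\mathcal D(L^* )$ is its $L^2(\Omega)$-adjoint. Standing assumptions: (i) there is $c_P^*>0$ with $c_P^*\|w\|\le\|L^*w\|$ for all $w\in\mathcal D(L^* )$; (ii) $L^*(\mathcal D(L^* ))=L^2(\Omega)$. (These imply that $Lu=f$ has a unique solution $\hat u\in\mathcal D(L)$ for each $f\in L^2(\Omega)$.) $\mathcal U^h\subset\mathcal D(L)$ and $\mathcal Z^{\mathfrak h}\subset\mathcal D(L^* )$ are (finite-dimensional) finite element spaces. Two-stage method: let $z_*=\operatorname{argmin}_{w\in\mathcal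 Z^{\mathfrak h}}\|L^*w-\hat u\|^2$ and then $u^h_{ts}=\operatorname{argmin}_{v^h\in\mathcal U^h}\|v^h-L^*z_*\|^2$. Single-stage method with weight $\omega>0$: $$(u^h_{ss},z_\bullet)=\operatorname{argmin}_{(v^h,w)\in\mathcal U^h\times\mathcal Z^{\mathfrak h}}\big[\omega\|L^*w-\hat u\|^2+\|v^h-L^*w\|^2\big].$$ *)

theory Defs
  imports "HOL-Analysis.Analysis"
begin

section \<open>The space $L^2(\Omega)$\<close>

text \<open>
  Elements of $L^2(\Omega)$ are represented by functions on the whole space, whose values outside
  \<open>\<Omega>\<close> are irrelevant. Equality in $L^2(\Omega)$ is equality almost everywhere on \<open>\<Omega>\<close>, and
  \<open>l2_norm\<close> is a seminorm on representatives.
\<close>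

definition L2 :: "(real ^ 'd) set \<Rightarrow> (real ^ 'd \<Rightarrow> real) set" where
  "L2 \<Omega> = {u \<in> borel_measurable (lebesgue_on \<Omega>). integrable (lebesgue_on \<Omega>) (\<lambda>x. (u x)\<^sup>2)}"

definition l2_inner :: "(real ^ 'd) set \<Rightarrow> (real ^ 'd \<Rightarrow> real) \<Rightarrow> (real ^ 'd \<Rightarrow> real) \<Rightarrow> real" where
  "l2_inner \<Omega> u v = (LINT x|lebesgue_on \<Omega>. u x * v x)"

definition l2_norm :: "(real ^ 'd) set \<Rightarrow> (real ^ 'd \<Rightarrow> real) \<Rightarrow> real" where
  "l2_norm \<Omega> u = sqrt (l2_inner \<Omega> u u)"

definition ae_eq :: "(real ^ 'd) set \<Rightarrow> (real ^ 'd \<Rightarrow> real) \<Rightarrow> (real ^ 'd \<Rightarrow> real) \<Rightarrow> bool" where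
  "ae_eq \<Omega> u v \<longleftrightarrow> (AE x in lebesgue_on \<Omega>. u x = v x)"

definition L2_loc :: "(real ^ 'd) set \<Rightarrow> (real ^ 'd \<Rightarrow> real) set" where
  "L2_loc \<Omega> = {c. \<forall>K. compact K \<and> K \<subseteq> \<Omega> \<longrightarrow> c \<in> L2 K}"


section \<open>First-order differential operators with homogeneous boundary conditions\<close>

definition partial_deriv :: "'d \<Rightarrow> (real ^ 'd \<Rightarrow> real) \<Rightarrow> real ^ 'd \<Rightarrow> real" where
  "partial_deriv i \<phi> x = frechet_derivative \<phi> (at x) (axis i 1)"

primrec C_k :: "nat \<Rightarrow> (real ^ 'd \<Rightarrow> real) \<Rightarrow> bool" where
  "C_k 0 \<phi> \<longleftrightarrow> continuous_on UNIV \<phi>"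
| "C_k (Suc k) \<phi> \<longleftrightarrow> (\<forall>x. \<phi> differentiable (at x)) \<and> (\<forall>i. C_k k (partial_deriv i \<phi>))"

definition test_functions :: "(real ^ 'd) set \<Rightarrow> (real ^ 'd \<Rightarrow> real) set" where
  "test_functions \<Omega> =
     {\<phi>. (\<forall>k. C_k k \<phi>) \<and> (\<exists>K. compact K \<and> K \<subseteq> \<Omega> \<and> (\<forall>x. x \<notin> K \<longrightarrow> \<phi> x = 0))}"

text \<open>
  The differential expression is \<open>u \<mapsto> \<Sum>\<^sub>i \<partial>\<^sub>i (b\<^sub>i u) + c u\<close>, in the sense of distributions on \<open>\<Omega>\<close>. For
  coefficients \<open>b\<^sub>i\<close>, \<open>c\<close> that are locally square integrable this makes sense for every square
  integrable \<open>u\<close>. An operator in the form \<open>\<Sum>\<^sub>i a\<^sub>i \<partial>\<^sub>i u + a\<^sub>0 u\<close> with weakly differentiable \<open>a\<^sub>i\<close> is the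
  case \<open>b = a\<close>, \<open>c = a\<^sub>0 - div a\<close>.
\<close>

definition diff_eq ::
  "(real ^ 'd) set \<Rightarrow> (real ^ 'd \<Rightarrow> real ^ 'd) \<Rightarrow> (real ^ 'd \<Rightarrow> real)
     \<Rightarrow> (real ^ 'd \<Rightarrow> real) \<Rightarrow> (real ^ 'd \<Rightarrow> real) \<Rightarrow> bool" where
  "diff_eq \<Omega> b c u g \<longleftrightarrow>
     (\<forall>\<phi> \<in> test_functions \<Omega>.
        l2_inner \<Omega> g \<phi> = l2_inner \<Omega> u (\<lambda>x. c x * \<phi> x - (\<Sum>i\<in>UNIV. b x $ i * partial_deriv i \<phi> x)))"

text \<open>The choice only selects a representative: \<open>g\<close> is unique almost everywhere on \<open>\<Omega>\<close>.\<close>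

definition diff_op ::
  "(real ^ 'd) set \<Rightarrow> (real ^ 'd \<Rightarrow> real ^ 'd) \<Rightarrow> (real ^ 'd \<Rightarrow> real)
     \<Rightarrow> (real ^ 'd \<Rightarrow> real) \<Rightarrow> (real ^ 'd \<Rightarrow> real)" where
  "diff_op \<Omega> b c u = (SOME g. g \<in> L2 \<Omega> \<and> diff_eq \<Omega> b c u g)"

definition maximal_domain ::
  "(real ^ 'd) set \<Rightarrow> (real ^ 'd \<Rightarrow> real ^ 'd) \<Rightarrow> (real ^ 'd \<Rightarrow> real) \<Rightarrow> (real ^ 'd \<Rightarrow> real) set" where
  "maximal_domain \<Omega> b c = {u \<in> L2 \<Omega>. \<exists>g \<in> L2 \<Omega>. diff_eq \<Omega> b c u g}"

text \<open>
  A boundary condition is given by the set \<open>BC\<close> of functions satisfying it. Homogeneity means that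
  it is stable under linear combinations. The last clause says that it only concerns the
  boundary: it is not affected by changing a function inside a compact subset of \<open>\<Omega>\<close> (or on a
  null set, which is the case \<open>K = {}\<close>).
\<close>

definition homogeneous_boundary_condition ::
  "(real ^ 'd) set \<Rightarrow> (real ^ 'd \<Rightarrow> real ^ 'd) \<Rightarrow> (real ^ 'd \<Rightarrow> real)
     \<Rightarrow> (real ^ 'd \<Rightarrow> real) set \<Rightarrow> bool" where
  "homogeneous_boundary_condition \<Omega> b c BC \<longleftrightarrow>
     (\<lambda>x. 0) \<in> BC \<and>
     (\<forall>u \<in> maximal_domain \<Omega> b c \<inter> BC. \<forall>v \<in> maximal_domain \<Omega> b c \<inter> BC.
        \<forall>\<alpha> \<beta>. (\<lambda>x. \<alpha> * u x + \<beta> * v x) \<in> BC) \<and>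
     (\<forall>u \<in> maximal_domain \<Omega> b c \<inter> BC. \<forall>v \<in> maximal_domain \<Omega> b c.
        \<forall>K. compact K \<and> K \<subseteq> \<Omega> \<and> (AE x in lebesgue_on \<Omega>. x \<notin> K \<longrightarrow> v x = u x) \<longrightarrow> v \<in> BC)"

definition diff_op_domain ::
  "(real ^ 'd) set \<Rightarrow> (real ^ 'd \<Rightarrow> real ^ 'd) \<Rightarrow> (real ^ 'd \<Rightarrow> real)
     \<Rightarrow> (real ^ 'd \<Rightarrow> real) set \<Rightarrow> (real ^ 'd \<Rightarrow> real) set" where
  "diff_op_domain \<Omega> b c BC = maximal_domain \<Omega> b c \<inter> BC"


section \<open>Unbounded operators in $L^2(\Omega)$\<close>

text \<open>An operator is given by its domain \<open>D\<close> and a function \<open>T\<close>, considered on \<open>D\<close> only.\<close>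

definition densely_defined :: "(real ^ 'd) set \<Rightarrow> (real ^ 'd \<Rightarrow> real) set \<Rightarrow> bool" where
  "densely_defined \<Omega> D \<longleftrightarrow> (\<forall>g \<in> L2 \<Omega>. \<forall>\<epsilon> > 0. \<exists>u \<in> D. l2_norm \<Omega> (\<lambda>x. u x - g x) < \<epsilon>)"

definition closed_operator ::
  "(real ^ 'd) set \<Rightarrow> (real ^ 'd \<Rightarrow> real) set
     \<Rightarrow> ((real ^ 'd \<Rightarrow> real) \<Rightarrow> (real ^ 'd \<Rightarrow> real)) \<Rightarrow> bool" where
  "closed_operator \<Omega> D T \<longleftrightarrow>
     (\<forall>U u g. (\<forall>n. U n \<in> D) \<and> u \<in> L2 \<Omega> \<and> g \<in> L2 \<Omega> \<and>
        (\<lambda>n. l2_norm \<Omega> (\<lambda>x. U n x - u x)) \<longlonglongrightarrow> 0 \<and>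
        (\<lambda>n. l2_norm \<Omega> (\<lambda>x. T (U n) x - g x)) \<longlonglongrightarrow> 0 \<longrightarrow>
        u \<in> D \<and> ae_eq \<Omega> (T u) g)"

definition adjoint_domain ::
  "(real ^ 'd) set \<Rightarrow> (real ^ 'd \<Rightarrow> real) set
     \<Rightarrow> ((real ^ 'd \<Rightarrow> real) \<Rightarrow> (real ^ 'd \<Rightarrow> real)) \<Rightarrow> (real ^ 'd \<Rightarrow> real) set" where
  "adjoint_domain \<Omega> D T =
     {w \<in> L2 \<Omega>. \<exists>g \<in> L2 \<Omega>. \<forall>u \<in> D. l2_inner \<Omega> (T u) w = l2_inner \<Omega> u g}"

text \<open>For dense \<open>D\<close> the function \<open>g\<close> is unique almost everywhere on \<open>\<Omega>\<close>.\<close>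

definition adjoint_op ::
  "(real ^ 'd) set \<Rightarrow> (real ^ 'd \<Rightarrow> real) set
     \<Rightarrow> ((real ^ 'd \<Rightarrow> real) \<Rightarrow> (real ^ 'd \<Rightarrow> real)) \<Rightarrow> (real ^ 'd \<Rightarrow> real) \<Rightarrow> (real ^ 'd \<Rightarrow> real)" where
  "adjoint_op \<Omega> D T w =
     (SOME g. g \<in> L2 \<Omega> \<and> (\<forall>u \<in> D. l2_inner \<Omega> (T u) w = l2_inner \<Omega> u g))"


section \<open>Finite-dimensional function spaces\<close>

text \<open>Finite element spaces enter only as spans of finitely many basis functions.\<close>

definition finite_dim_space :: "(real ^ 'd \<Rightarrow> real) set \<Rightarrow> bool" where
  "finite_dim_space V \<longleftrightarrow>
     (\<exists>B. finite B \<and> V = {\<lambda>x. \<Sum>\<phi>\<in>B. a \<phi> * \<phi> x | a. True})"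

end

theory Submission
  imports Defs
begin

text \<open>
  If \<open>p\<close> is the orthogonal projection of \<open>t\<close> onto a subspace \<open>W\<close>, then
  \<open>\<parallel>p - x\<parallel> \<le> \<parallel>t - x\<parallel> + \<parallel>w - x\<parallel>\<close> for all \<open>x\<close> and all \<open>w \<in> W\<close>. In both methods the discrete solution is
  the projection of \<open>L\<^sup>* z\<close> onto \<open>U\<close>, hence
  \<open>\<parallel>u - u_hat\<parallel> \<le> \<parallel>L\<^sup>* z - u_hat\<parallel> + inf \<parallel>v - u_hat\<parallel>\<close>, which settles the two-stage method. In the
  single-stage method, completing the square shows that \<open>L\<^sup>* z\<close> is the projection of
  \<open>(\<omega> u_hat + u) / (\<omega> + 1)\<close> onto \<open>L\<^sup>* Z\<close>, so that
  \<open>\<parallel>L\<^sup>* z - u_hat\<parallel> \<le> \<parallel>u - u_hat\<parallel> / (\<omega> + 1) + inf \<parallel>L\<^sup>* w - u_hat\<parallel>\<close>; the first term is absorbed on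
  the left.
\<close>

section \<open>Linear structure and bilinearity on representatives\<close>

text \<open>Domination by \<open>u\<^sup>2 + v\<^sup>2\<close>. This supplies the integrability on
  which additivity of \<open>l2_inner\<close> rests.\<close>

lemma L2_mult_integrable:
  assumes "u \<in> L2 \<Omega>" "v \<in> L2 \<Omega>"
  shows "integrable (lebesgue_on \<Omega>) (\<lambda>x. u x * v x)"
proof (rule Bochner_Integration.integrable_bound)
  show "integrable (lebesgue_on \<Omega>) (\<lambda>x. (u x)\<^sup>2 + (v x)\<^sup>2)"
    using assms by (simp add: L2_def)
  show "(\<lambda>x. u x * v x) \<in> borel_measurable (lebesgue_on \<Omega>)"
    using assms by (auto simp: L2_def)
  have "\<bar>p * q\<bar> \<le> p\<^sup>2 + q\<^sup>2" for p q :: real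
  proof -
    have "2 * \<bar>p\<bar> * \<bar>q\<bar> \<le> p\<^sup>2 + q\<^sup>2"
      using sum_squares_bound[of "\<bar>p\<bar>" "\<bar>q\<bar>"] by simp
    moreover have "0 \<le> \<bar>p\<bar> * \<bar>q\<bar>" by simp
    ultimately show ?thesis unfolding abs_mult by linarith
  qed
  then show "AE x in lebesgue_on \<Omega>. norm (u x * v x) \<le> norm ((u x)\<^sup>2 + (v x)\<^sup>2)"
    by simp
qed

lemma L2_add:
  assumes "u \<in> L2 \<Omega>" "v \<in> L2 \<Omega>"
  shows "(\<lambda>x. u x + v x) \<in> L2 \<Omega>"
proof -
  have "integrable (lebesgue_on \<Omega>) (\<lambda>x. (u x)\<^sup>2 + (v x)\<^sup>2 + 2 * (u x * v x))"
    using assms L2_mult_integrable[OF assms] by (simp add: L2_def)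
  then show ?thesis
    using assms by (auto simp: L2_def power2_sum mult.assoc)
qed

lemma L2_scale:
  assumes "u \<in> L2 \<Omega>"
  shows "(\<lambda>x. a * u x) \<in> L2 \<Omega>"
  using assms by (auto simp: L2_def power_mult_distrib)

lemma L2_diff:
  assumes "u \<in> L2 \<Omega>" "v \<in> L2 \<Omega>"
  shows "(\<lambda>x. u x - v x) \<in> L2 \<Omega>"
  using L2_add[OF assms(1) L2_scale[OF assms(2), of "-1"]] by simp

lemma l2_inner_commute: "l2_inner \<Omega> u v = l2_inner \<Omega> v u"
  by (simp add: l2_inner_def mult.commute)

lemma l2_inner_self_nonneg: "0 \<le> l2_inner \<Omega> u u"
  by (simp add: l2_inner_def)

lemma l2_norm_nonneg: "0 \<le> l2_norm \<Omega> u"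
  by (simp add: l2_norm_def l2_inner_self_nonneg)

lemma l2_norm_squared: "(l2_norm \<Omega> u)\<^sup>2 = l2_inner \<Omega> u u"
  by (simp add: l2_norm_def l2_inner_self_nonneg)

lemma l2_inner_add_left:
  assumes "u \<in> L2 \<Omega>" "v \<in> L2 \<Omega>" "w \<in> L2 \<Omega>"
  shows "l2_inner \<Omega> (\<lambda>x. u x + v x) w = l2_inner \<Omega> u w + l2_inner \<Omega> v w"
  using assms by (simp add: l2_inner_def distrib_right L2_mult_integrable)

lemma l2_inner_diff_left:
  assumes "u \<in> L2 \<Omega>" "v \<in> L2 \<Omega>" "w \<in> L2 \<Omega>"
  shows "l2_inner \<Omega> (\<lambda>x. u x - v x) w = l2_inner \<Omega> u w - l2_inner \<Omega> v w"
  using assms by (simp add: l2_inner_def left_diff_distrib L2_mult_integrable)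

lemma l2_inner_scale_left: "l2_inner \<Omega> (\<lambda>x. a * u x) w = a * l2_inner \<Omega> u w"
  by (simp add: l2_inner_def mult.assoc)

lemma l2_inner_add_right:
  assumes "u \<in> L2 \<Omega>" "v \<in> L2 \<Omega>" "w \<in> L2 \<Omega>"
  shows "l2_inner \<Omega> w (\<lambda>x. u x + v x) = l2_inner \<Omega> w u + l2_inner \<Omega> w v"
  using l2_inner_add_left[OF assms] by (simp add: l2_inner_commute)

lemma l2_inner_diff_right:
  assumes "u \<in> L2 \<Omega>" "v \<in> L2 \<Omega>" "w \<in> L2 \<Omega>"
  shows "l2_inner \<Omega> w (\<lambda>x. u x - v x) = l2_inner \<Omega> w u - l2_inner \<Omega> w v"
  using l2_inner_diff_left[OF assms] by (simp add: l2_inner_commute)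

lemma l2_inner_scale_right: "l2_inner \<Omega> w (\<lambda>x. a * u x) = a * l2_inner \<Omega> w u"
  using l2_inner_scale_left[of \<Omega> a u w] by (simp add: l2_inner_commute)

lemmas L2_closed = L2_add L2_diff L2_scale

lemmas l2_inner_linear =
  l2_inner_add_left l2_inner_diff_left l2_inner_scale_left
  l2_inner_add_right l2_inner_diff_right l2_inner_scale_right

lemma l2_norm_minus_commute: "l2_norm \<Omega> (\<lambda>x. u x - v x) = l2_norm \<Omega> (\<lambda>x. v x - u x)"
proof -
  have "(u x - v x) * (u x - v x) = (v x - u x) * (v x - u x)" for x
    by (simp add: algebra_simps)
  then show ?thesis by (simp add: l2_norm_def l2_inner_def)
qed

lemma l2_norm_scale: "l2_norm \<Omega> (\<lambda>x. a * u x) = \<bar>a\<bar> * l2_norm \<Omega> u"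
  by (simp add: l2_norm_def l2_inner_scale_left l2_inner_scale_right real_sqrt_mult
      flip: mult.assoc)

section \<open>Cauchy-Schwarz and triangle inequality\<close>

text \<open>Evaluation at the minimiser settles \<gamma> > 0; the case \<gamma> = 0 is kept because
  \<gamma> will be a squared seminorm. Besides Cauchy-Schwarz, the instance \<alpha> = 0 turns
  minimality along a line into orthogonality.\<close>

lemma nonneg_quadratic_discriminant:
  fixes \<alpha> \<beta> \<gamma> :: real
  assumes nonneg: "\<And>\<tau>. 0 \<le> \<alpha> + 2 * \<tau> * \<beta> + \<tau>\<^sup>2 * \<gamma>" and "0 \<le> \<gamma>"
  shows "\<beta>\<^sup>2 \<le> \<alpha> * \<gamma>"
proof (cases "\<gamma> = 0")
  case True
  have "\<beta> = 0"
  proof (rule ccontr)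
    assume "\<beta> \<noteq> 0"
    \<comment> \<open>The chosen point makes \<open>\<alpha> + 2 * \<tau> * \<beta>\<close> equal to
      -1.\<close>
    then show False
      using nonneg[of "- (\<alpha> + 1) / (2 * \<beta>)"] True by (simp add: field_simps)
  qed
  then show ?thesis using True by simp
next
  case False
  then have "\<gamma> > 0" using \<open>0 \<le> \<gamma>\<close> by simp
  then show ?thesis
    using nonneg[of "- \<beta> / \<gamma>"] by (simp add: field_simps power2_eq_square)
qed

lemma l2_inner_le_norm:
  assumes "u \<in> L2 \<Omega>" "v \<in> L2 \<Omega>"
  shows "l2_inner \<Omega> u v \<le> l2_norm \<Omega> u * l2_norm \<Omega> v"
proof -
  have "0 \<le> l2_inner \<Omega> u u + 2 * \<tau> * l2_inner \<Omega> u v + \<tau>\<^sup>2 * l2_inner \<Omega> v v" for \<tau>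
    using l2_inner_self_nonneg[of \<Omega> "\<lambda>x. u x + \<tau> * v x"] assms
    by (simp add: l2_inner_linear L2_closed l2_inner_commute algebra_simps
        power2_eq_square)
  then have "(l2_inner \<Omega> u v)\<^sup>2 \<le> l2_inner \<Omega> u u * l2_inner \<Omega> v v"
    by (rule nonneg_quadratic_discriminant) (rule l2_inner_self_nonneg)
  also have "\<dots> = (l2_norm \<Omega> u * l2_norm \<Omega> v)\<^sup>2"
    by (simp add: power_mult_distrib l2_norm_squared)
  finally show ?thesis
    by (rule power2_le_imp_le) (simp add: l2_norm_nonneg)
qed

lemma l2_norm_triangle:
  assumes "u \<in> L2 \<Omega>" "v \<in> L2 \<Omega>"
  shows "l2_norm \<Omega> (\<lambda>x. u x + v x) \<le> l2_norm \<Omega> u + l2_norm \<Omega> v"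
proof (rule power2_le_imp_le)
  show "(l2_norm \<Omega> (\<lambda>x. u x + v x))\<^sup>2 \<le> (l2_norm \<Omega> u + l2_norm \<Omega> v)\<^sup>2"
    using assms l2_inner_le_norm[OF assms]
    by (simp add: power2_sum l2_norm_squared l2_inner_linear L2_closed l2_inner_commute)
qed (simp add: l2_norm_nonneg)

lemma l2_dist_triangle:
  assumes "u \<in> L2 \<Omega>" "v \<in> L2 \<Omega>" "w \<in> L2 \<Omega>"
  shows "l2_norm \<Omega> (\<lambda>x. u x - w x) \<le> l2_norm \<Omega> (\<lambda>x. u x - v x) + l2_norm \<Omega> (\<lambda>x. v x - w x)"
  using l2_norm_triangle[of "\<lambda>x. u x - v x" \<Omega> "\<lambda>x. v x - w x"] assms by (simp add: L2_diff)

section \<open>Best approximation\<close>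

text \<open>Minimality along the line through \<open>p\<close> and \<open>w\<close> makes
  \<open>p - t\<close> orthogonal to \<open>w - p\<close>. The line is written with pointwise
  combinations, so that the lemma applies to \<open>U\<close> as well as to images under
  \<open>adjoint_op\<close>, whose chosen representatives need not combine linearly.\<close>

lemma best_approximation_dist_le:
  assumes L2: "p \<in> L2 \<Omega>" "t \<in> L2 \<Omega>" "x \<in> L2 \<Omega>" "w \<in> L2 \<Omega>"
    and min: "\<And>\<tau> :: real. l2_norm \<Omega> (\<lambda>y. p y - t y) \<le> l2_norm \<Omega> (\<lambda>y. (1 - \<tau>) * p y + \<tau> * w y - t y)"
  shows "l2_norm \<Omega> (\<lambda>y. p y - x y) \<le> l2_norm \<Omega> (\<lambda>y. t y - x y) + l2_norm \<Omega> (\<lambda>y. w y - x y)"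
    (is "?a \<le> ?q + ?d")
proof (rule ccontr)
  \<comment> \<open>The difference of the squared distances in \<open>min\<close> is a nonnegative
    quadratic in \<tau> with constant term 0, which forces its linear coefficient to vanish.\<close>
  have "0 \<le> 0 + 2 * \<tau> * l2_inner \<Omega> (\<lambda>y. p y - t y) (\<lambda>y. w y - p y)
      + \<tau>\<^sup>2 * l2_inner \<Omega> (\<lambda>y. w y - p y) (\<lambda>y. w y - p y)" for \<tau>
    using power_mono[OF min[of \<tau>] l2_norm_nonneg, where n = 2] L2
    by (simp add: l2_norm_squared l2_inner_linear L2_closed l2_inner_commute)
      (simp add: algebra_simps power2_eq_square)
  then have "(l2_inner \<Omega> (\<lambda>y. p y - t y) (\<lambda>y. w y - p y))\<^sup>2
      \<le> 0 * l2_inner \<Omega> (\<lambda>y. w y - p y) (\<lambda>y. w y - p y)"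
    by (rule nonneg_quadratic_discriminant) (rule l2_inner_self_nonneg)
  then have orth: "l2_inner \<Omega> (\<lambda>y. p y - t y) (\<lambda>y. w y - p y) = 0"
    by simp
  assume "\<not> ?a \<le> ?q + ?d"
  moreover have nn: "0 \<le> ?a" "0 \<le> ?q" "0 \<le> ?d"
    by (simp_all add: l2_norm_nonneg)
  \<comment> \<open>Product of \<open>?a > ?q + ?d\<close> and \<open>?a - ?q > ?d\<close>. The
    estimates that follow lead back to the left-hand side.\<close>
  ultimately have "(?q + ?d) * ?d < ?a * (?a - ?q)"
    by (intro mult_strict_mono') auto
  also have "\<dots> = ?a\<^sup>2 - ?q * ?a"
    by (simp add: algebra_simps power2_eq_square)
  \<comment> \<open>One factor \<open>p - x\<close> is split at \<open>t\<close>; against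
    \<open>p - t\<close>, orthogonality lets \<open>w - x\<close> replace the other factor
    \<open>p - x\<close>.\<close>
  also have "?a\<^sup>2 = l2_inner \<Omega> (\<lambda>y. t y - x y) (\<lambda>y. p y - x y)
      + l2_inner \<Omega> (\<lambda>y. p y - t y) (\<lambda>y. w y - x y)"
    using orth L2
    by (simp add: l2_norm_squared l2_inner_linear L2_closed l2_inner_commute algebra_simps)
  also have "\<dots> \<le> ?q * ?a + l2_norm \<Omega> (\<lambda>y. p y - t y) * ?d"
    using L2 by (intro add_mono l2_inner_le_norm L2_diff)
  \<comment> \<open>At \<tau> = 1 the competitor is \<open>w\<close> itself.\<close>
  also have "l2_norm \<Omega> (\<lambda>y. p y - t y) \<le> ?q + ?d"
    using min[of 1] l2_dist_triangle[of w \<Omega> x t] L2 l2_norm_minus_commute[of \<Omega> x t] by simp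
  finally show False using nn by (simp add: mult_right_mono)
qed

section \<open>The adjoint up to null sets\<close>

lemma adjoint_op_L2:
  assumes "w \<in> adjoint_domain \<Omega> D T"
  shows "adjoint_op \<Omega> D T w \<in> L2 \<Omega>"
    and "u \<in> D \<Longrightarrow> l2_inner \<Omega> (T u) w = l2_inner \<Omega> u (adjoint_op \<Omega> D T w)"
proof -
  have "\<exists>g. g \<in> L2 \<Omega> \<and> (\<forall>u\<in>D. l2_inner \<Omega> (T u) w = l2_inner \<Omega> u g)"
    using assms by (auto simp: adjoint_domain_def)
  from someI_ex[OF this] show "adjoint_op \<Omega> D T w \<in> L2 \<Omega>"
    and "u \<in> D \<Longrightarrow> l2_inner \<Omega> (T u) w = l2_inner \<Omega> u (adjoint_op \<Omega> D T w)"
    by (auto simp: adjoint_op_def)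
qed

text \<open>Some \<open>u\<close> in \<open>D\<close> is closer to \<open>g\<close> than the norm of
  \<open>g\<close>. Orthogonality gives \<open><g, g> = <g - u, g>\<close>, which Cauchy-Schwarz
  makes smaller than the squared norm of \<open>g\<close>.\<close>

lemma l2_norm_eq_0_if_orthogonal_dense:
  assumes "densely_defined \<Omega> D" "D \<subseteq> L2 \<Omega>" "g \<in> L2 \<Omega>"
    and orth: "\<And>u. u \<in> D \<Longrightarrow> l2_inner \<Omega> u g = 0"
  shows "l2_norm \<Omega> g = 0"
proof (rule ccontr)
  assume "l2_norm \<Omega> g \<noteq> 0"
  then have pos: "0 < l2_norm \<Omega> g"
    using l2_norm_nonneg[of \<Omega> g] by simp
  then obtain u where u: "u \<in> D" "l2_norm \<Omega> (\<lambda>x. u x - g x) < l2_norm \<Omega> g"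
    using assms(1,3) by (auto simp: densely_defined_def)
  then have "u \<in> L2 \<Omega>" using assms(2) by auto
  have "(l2_norm \<Omega> g)\<^sup>2 = l2_inner \<Omega> (\<lambda>x. g x - u x) g"
    using \<open>u \<in> L2 \<Omega>\<close> assms(3) orth[OF u(1)] by (simp add: l2_norm_squared l2_inner_linear)
  also have "\<dots> \<le> l2_norm \<Omega> (\<lambda>x. u x - g x) * l2_norm \<Omega> g"
    using l2_inner_le_norm[of "\<lambda>x. g x - u x" \<Omega> g] \<open>u \<in> L2 \<Omega>\<close> assms(3)
    by (simp add: L2_diff l2_norm_minus_commute[of \<Omega> g u])
  also have "\<dots> < (l2_norm \<Omega> g)\<^sup>2"
    using u(2) pos by (simp add: power2_eq_square)
  finally show False by simp
qed

text \<open>The triangle inequality in both directions; one representative may thus replace another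
  inside a distance.\<close>

lemma l2_dist_eq_if_norm_diff_eq_0:
  assumes "g \<in> L2 \<Omega>" "h \<in> L2 \<Omega>" "t \<in> L2 \<Omega>" "l2_norm \<Omega> (\<lambda>x. g x - h x) = 0"
  shows "l2_norm \<Omega> (\<lambda>x. g x - t x) = l2_norm \<Omega> (\<lambda>x. h x - t x)"
  using l2_dist_triangle[of g \<Omega> h t] l2_dist_triangle[of h \<Omega> g t] assms
    l2_norm_minus_commute[of \<Omega> g h] by simp

text \<open>Since \<open>adjoint_op\<close> chooses a representative, it is linear only up to null sets.\<close>

lemma adjoint_op_dist_linear:
  assumes dense: "densely_defined \<Omega> D" "D \<subseteq> L2 \<Omega>" and T: "\<And>u. u \<in> D \<Longrightarrow> T u \<in> L2 \<Omega>"
    and z: "z \<in> adjoint_domain \<Omega> D T" and w: "w \<in> adjoint_domain \<Omega> D T"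
    and comb: "(\<lambda>x. \<alpha> * z x + \<beta> * w x) \<in> adjoint_domain \<Omega> D T" and t: "t \<in> L2 \<Omega>"
  shows "l2_norm \<Omega> (\<lambda>x. adjoint_op \<Omega> D T (\<lambda>x. \<alpha> * z x + \<beta> * w x) x - t x)
    = l2_norm \<Omega> (\<lambda>x. \<alpha> * adjoint_op \<Omega> D T z x + \<beta> * adjoint_op \<Omega> D T w x - t x)"
proof (rule l2_dist_eq_if_norm_diff_eq_0[OF _ _ t])
  note A = adjoint_op_L2[OF z] adjoint_op_L2[OF w] adjoint_op_L2[OF comb]
  show "adjoint_op \<Omega> D T (\<lambda>x. \<alpha> * z x + \<beta> * w x) \<in> L2 \<Omega>"
    and "(\<lambda>x. \<alpha> * adjoint_op \<Omega> D T z x + \<beta> * adjoint_op \<Omega> D T w x) \<in> L2 \<Omega>"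
    using A by (auto intro!: L2_closed)
  have L2: "z \<in> L2 \<Omega>" "w \<in> L2 \<Omega>" using z w by (auto simp: adjoint_domain_def)
  show "l2_norm \<Omega> (\<lambda>x. adjoint_op \<Omega> D T (\<lambda>x. \<alpha> * z x + \<beta> * w x) x
      - (\<alpha> * adjoint_op \<Omega> D T z x + \<beta> * adjoint_op \<Omega> D T w x)) = 0"
  proof (rule l2_norm_eq_0_if_orthogonal_dense[OF dense])
    fix u assume u: "u \<in> D"
    then have "u \<in> L2 \<Omega>" using dense(2) by auto
    \<comment> \<open>Read backwards, the defining identities turn each pairing with an adjoint into
      a pairing with \<open>T u\<close>, where linearity is exact.\<close>
    then show "l2_inner \<Omega> u (\<lambda>x. adjoint_op \<Omega> D T (\<lambda>x. \<alpha> * z x + \<beta> * w x) x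
      - (\<alpha> * adjoint_op \<Omega> D T z x + \<beta> * adjoint_op \<Omega> D T w x)) = 0"
      using A(1,3,5) L2 T[OF u]
      by (simp add: l2_inner_linear L2_closed A(2,4,6)[OF u, symmetric])
  qed (use A in \<open>auto intro!: L2_closed\<close>)
qed

section \<open>Discrete spaces and the domain of the differential operator\<close>

lemma finite_dim_space_linear:
  assumes "finite_dim_space V" "u \<in> V" "v \<in> V"
  shows "(\<lambda>x. \<alpha> * u x + \<beta> * v x) \<in> V"
proof -
  obtain B where V: "V = {\<lambda>x. \<Sum>\<phi>\<in>B. a \<phi> * \<phi> x | a. True}"
    using assms(1) by (auto simp: finite_dim_space_def)
  obtain a a' where u: "u = (\<lambda>x. \<Sum>\<phi>\<in>B. a \<phi> * \<phi> x)" and v: "v = (\<lambda>x. \<Sum>\<phi>\<in>B. a' \<phi> * \<phi> x)"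
    using assms(2,3) by (auto simp: V)
  have "(\<lambda>x. \<alpha> * u x + \<beta> * v x) = (\<lambda>x. \<Sum>\<phi>\<in>B. (\<alpha> * a \<phi> + \<beta> * a' \<phi>) * \<phi> x)"
    by (simp add: u v sum_distrib_left sum.distrib distrib_right mult.assoc)
  then show ?thesis unfolding V by (intro CollectI exI conjI) auto
qed

lemma diff_op_domain_L2:
  assumes "u \<in> diff_op_domain \<Omega> b c BC"
  shows "u \<in> L2 \<Omega>" and "diff_op \<Omega> b c u \<in> L2 \<Omega>"
proof -
  show "u \<in> L2 \<Omega>" using assms by (simp add: diff_op_domain_def maximal_domain_def)
  have "\<exists>g. g \<in> L2 \<Omega> \<and> diff_eq \<Omega> b c u g"
    using assms by (auto simp: diff_op_domain_def maximal_domain_def)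
  from someI_ex[OF this] show "diff_op \<Omega> b c u \<in> L2 \<Omega>"
    by (simp add: diff_op_def)
qed

section \<open>Completing the square and passing to infima\<close>

text \<open>The centre is the mean of \<open>g\<close> and \<open>u\<close> with weights \<omega> :
  1. The last summand is free of \<open>y\<close>, so minimising over \<open>y\<close> at fixed
  \<open>u\<close> is best approximation of that centre.\<close>

lemma weighted_l2_dist_complete_square:
  assumes "y \<in> L2 \<Omega>" "u \<in> L2 \<Omega>" "g \<in> L2 \<Omega>" "\<omega> > 0"
  shows "\<omega> * (l2_norm \<Omega> (\<lambda>x. y x - g x))\<^sup>2 + (l2_norm \<Omega> (\<lambda>x. u x - y x))\<^sup>2
    = (\<omega> + 1) * (l2_norm \<Omega> (\<lambda>x. y x - 1 / (\<omega> + 1) * (\<omega> * g x + u x)))\<^sup>2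
      + \<omega> / (\<omega> + 1) * (l2_norm \<Omega> (\<lambda>x. u x - g x))\<^sup>2"
proof -
  define r where "r = 1 / (\<omega> + 1)"
  have r: "\<omega> = (1 - r) / r" "0 < r" "\<omega> / (\<omega> + 1) = 1 - r" "\<omega> + 1 = 1 / r"
    using assms(4) by (auto simp: r_def field_simps)
  have 1: "(l2_norm \<Omega> (\<lambda>x. y x - r * (\<omega> * g x + u x)))\<^sup>2
      = l2_inner \<Omega> y y - 2 * r * (\<omega> * l2_inner \<Omega> y g + l2_inner \<Omega> y u)
        + r\<^sup>2 * (\<omega>\<^sup>2 * l2_inner \<Omega> g g + 2 * \<omega> * l2_inner \<Omega> g u + l2_inner \<Omega> u u)"
    using assms(1-3)
    by (simp add: l2_norm_squared l2_inner_linear L2_closed l2_inner_commute)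
      (simp add: algebra_simps power2_eq_square)
  have 2: "(l2_norm \<Omega> (\<lambda>x. p x - q x))\<^sup>2
      = l2_inner \<Omega> p p - 2 * l2_inner \<Omega> p q + l2_inner \<Omega> q q"
    if "p \<in> L2 \<Omega>" "q \<in> L2 \<Omega>" for p q
    using that by (simp add: l2_norm_squared l2_inner_linear L2_closed l2_inner_commute)
  have "(\<omega> + 1) * (l2_norm \<Omega> (\<lambda>x. y x - r * (\<omega> * g x + u x)))\<^sup>2
      + \<omega> / (\<omega> + 1) * (l2_norm \<Omega> (\<lambda>x. u x - g x))\<^sup>2
    = \<omega> * (l2_norm \<Omega> (\<lambda>x. y x - g x))\<^sup>2 + (l2_norm \<Omega> (\<lambda>x. u x - y x))\<^sup>2"
    unfolding 1 2[OF assms(1,3)] 2[OF assms(2,1)] 2[OF assms(2,3)]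
    \<comment> \<open>The order matters: the patterns \<open>\<omega> / (\<omega> + 1)\<close> and
      \<open>\<omega> + 1\<close> must be replaced before \<omega> itself disappears.\<close>
    unfolding r(3) unfolding r(4) unfolding r(1)
    using r(2) by (simp add: l2_inner_commute field_simps power2_eq_square)
  then show ?thesis by (simp add: r_def)
qed

text \<open>The infima are taken one after the other: at fixed \<open>w\<close> the inequality,
  solved for \<open>F v\<close>, bounds \<open>F\<close> from below on \<open>U\<close>; the result
  is then solved for \<open>G w\<close>.\<close>

lemma le_weighted_INF_add:
  fixes F G :: "'a \<Rightarrow> real"
  assumes "U \<noteq> {}" "Z \<noteq> {}" "0 < s" "0 < t"
    and le: "\<And>v w. v \<in> U \<Longrightarrow> w \<in> Z \<Longrightarrow> a \<le> s * F v + t * G w"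
  shows "a \<le> s * (INF v\<in>U. F v) + t * (INF w\<in>Z. G w)"
proof -
  have "(a - s * (INF v\<in>U. F v)) / t \<le> (INF w\<in>Z. G w)"
  proof (rule cINF_greatest[OF assms(2)])
    fix w assume "w \<in> Z"
    have "(a - t * G w) / s \<le> (INF v\<in>U. F v)"
      using le[OF _ \<open>w \<in> Z\<close>] assms(3)
      by (intro cINF_greatest[OF assms(1)]) (simp add: field_simps)
    then show "(a - s * (INF v\<in>U. F v)) / t \<le> G w"
      using assms(3,4) by (simp add: field_simps)
  qed
  then show ?thesis using assms(4) by (simp add: field_simps)
qed

section \<open>The error bound for both methods\<close>

theorem theorem5p2:
  fixes \<Omega> :: "(real ^ 'd) set"
    and b :: "real ^ 'd \<Rightarrow> real ^ 'd" and c :: "real ^ 'd \<Rightarrow> real"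
    and BC D Ds U Z :: "(real ^ 'd \<Rightarrow> real) set"
    and L Ls :: "(real ^ 'd \<Rightarrow> real) \<Rightarrow> (real ^ 'd \<Rightarrow> real)"
    and f u_hat u_ts z_ts u_ss z_ss u_h :: "real ^ 'd \<Rightarrow> real"
    and c_P \<omega> s :: real
  assumes domain: "open \<Omega>" "connected \<Omega>" "\<Omega> \<noteq> {}"
    and coefficients: "\<And>i. (\<lambda>x. b x $ i) \<in> L2_loc \<Omega>" "c \<in> L2_loc \<Omega>"
    and boundary_condition: "homogeneous_boundary_condition \<Omega> b c BC"
    and operator: "D = diff_op_domain \<Omega> b c BC" "L = diff_op \<Omega> b c"
    and closed_op: "closed_operator \<Omega> D L"
    and dense: "densely_defined \<Omega> D"
    and adjoint: "Ds = adjoint_domain \<Omega> D L" "Ls = adjoint_op \<Omega> D L"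
    and poincare: "c_P > 0" "\<And>w. w \<in> Ds \<Longrightarrow> c_P * l2_norm \<Omega> w \<le> l2_norm \<Omega> (Ls w)"
    and surjective: "\<And>g. g \<in> L2 \<Omega> \<Longrightarrow> \<exists>w \<in> Ds. ae_eq \<Omega> (Ls w) g"
    and U: "finite_dim_space U" "U \<subseteq> D"
    and Z: "finite_dim_space Z" "Z \<subseteq> Ds"
    and exact_solution: "f \<in> L2 \<Omega>" "u_hat \<in> D" "ae_eq \<Omega> (L u_hat) f"
    and weight: "\<omega> > 0"
    and two_stage:
      "is_arg_min (\<lambda>w. (l2_norm \<Omega> (\<lambda>x. Ls w x - u_hat x))\<^sup>2) (\<lambda>w. w \<in> Z) z_ts"
      "is_arg_min (\<lambda>v. (l2_norm \<Omega> (\<lambda>x. v x - Ls z_ts x))\<^sup>2) (\<lambda>v. v \<in> U) u_ts"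
    and single_stage:
      "is_arg_min
         (\<lambda>(v, w). \<omega> * (l2_norm \<Omega> (\<lambda>x. Ls w x - u_hat x))\<^sup>2 + (l2_norm \<Omega> (\<lambda>x. v x - Ls w x))\<^sup>2)
         (\<lambda>p. p \<in> U \<times> Z) (u_ss, z_ss)"
    and choice: "(u_h = u_ss \<and> s = (\<omega> + 1) / \<omega>) \<or> (u_h = u_ts \<and> s = 1)"
  shows "l2_norm \<Omega> (\<lambda>x. u_h x - u_hat x)
           \<le> s * (INF v\<in>U. l2_norm \<Omega> (\<lambda>x. v x - u_hat x))
             + (s + 1) * (INF w\<in>Z. l2_norm \<Omega> (\<lambda>x. Ls w x - u_hat x))"
proof -
  let ?N = "l2_norm \<Omega>"
  have D_L2: "D \<subseteq> L2 \<Omega>" and L_L2: "\<And>u. u \<in> D \<Longrightarrow> L u \<in> L2 \<Omega>"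
    using diff_op_domain_L2 by (auto simp: operator)
  have U_L2: "v \<in> L2 \<Omega>" if "v \<in> U" for v
    using that U(2) D_L2 by auto
  have hat: "u_hat \<in> L2 \<Omega>"
    using exact_solution(2) D_L2 by auto
  have Z_L2: "Ls w \<in> L2 \<Omega>" if "w \<in> Z" for w
    using that Z(2) adjoint_op_L2(1)[of w \<Omega> D L] by (auto simp: adjoint)
  \<comment> \<open>Shared by both methods: \<open>u\<close> is the best approximation in
    \<open>U\<close> of \<open>Ls z\<close>, whichever \<open>z\<close> the method produces.\<close>
  have project_U: "?N (\<lambda>x. u x - u_hat x) \<le> ?N (\<lambda>x. Ls z x - u_hat x) + ?N (\<lambda>x. v x - u_hat x)"
    if "u \<in> U" "z \<in> Z" "v \<in> U"
      and min: "\<And>v. v \<in> U \<Longrightarrow> ?N (\<lambda>x. u x - Ls z x) \<le> ?N (\<lambda>x. v x - Ls z x)" for u z v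
    using that U_L2 Z_L2 hat finite_dim_space_linear[OF U(1)]
    by (intro best_approximation_dist_le) auto
  have ts: "z_ts \<in> Z" "u_ts \<in> U"
    and ts_min: "\<And>w. w \<in> Z \<Longrightarrow> ?N (\<lambda>x. Ls z_ts x - u_hat x) \<le> ?N (\<lambda>x. Ls w x - u_hat x)"
      "\<And>v. v \<in> U \<Longrightarrow> ?N (\<lambda>x. u_ts x - Ls z_ts x) \<le> ?N (\<lambda>x. v x - Ls z_ts x)"
    using two_stage by (auto simp: is_arg_min_linorder intro: power2_le_imp_le l2_norm_nonneg)
  have ss: "u_ss \<in> U" "z_ss \<in> Z"
    and ss_min: "\<And>v w. v \<in> U \<Longrightarrow> w \<in> Z \<Longrightarrow>
      \<omega> * (?N (\<lambda>x. Ls z_ss x - u_hat x))\<^sup>2 + (?N (\<lambda>x. u_ss x - Ls z_ss x))\<^sup>2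
      \<le> \<omega> * (?N (\<lambda>x. Ls w x - u_hat x))\<^sup>2 + (?N (\<lambda>x. v x - Ls w x))\<^sup>2"
    using single_stage by (auto simp: is_arg_min_linorder)
  \<comment> \<open>The centre of the completed square for \<open>g = u_hat\<close> and
    \<open>u = u_ss\<close>.\<close>
  define t where "t = (\<lambda>x. 1 / (\<omega> + 1) * (\<omega> * u_hat x + u_ss x))"
  have t_L2: "t \<in> L2 \<Omega>"
    unfolding t_def using hat U_L2[OF ss(1)] by (intro L2_closed)
  \<comment> \<open>Source of the factor \<open>1 / (\<omega> + 1)\<close>, which makes the later
    absorption possible.\<close>
  have "(\<lambda>x. t x - u_hat x) = (\<lambda>x. 1 / (\<omega> + 1) * (u_ss x - u_hat x))"
    using weight by (auto simp: t_def field_simps)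
  then have t_dist: "?N (\<lambda>x. t x - u_hat x) = ?N (\<lambda>x. u_ss x - u_hat x) / (\<omega> + 1)"
    using weight by (simp only: l2_norm_scale) simp
  \<comment> \<open>Joint minimality is tested with the first component kept at \<open>u_ss\<close>;
    the term free of \<open>y\<close> then cancels.\<close>
  have z_min: "?N (\<lambda>x. Ls z_ss x - t x) \<le> ?N (\<lambda>x. Ls w x - t x)" if "w \<in> Z" for w
  proof (rule power2_le_imp_le[OF _ l2_norm_nonneg])
    have "(\<omega> + 1) * (?N (\<lambda>x. Ls z_ss x - t x))\<^sup>2 \<le> (\<omega> + 1) * (?N (\<lambda>x. Ls w x - t x))\<^sup>2"
      using ss_min[OF ss(1) that]
        weighted_l2_dist_complete_square[OF Z_L2[OF that] U_L2[OF ss(1)] hat weight]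
        weighted_l2_dist_complete_square[OF Z_L2[OF ss(2)] U_L2[OF ss(1)] hat weight]
      unfolding t_def by linarith
    then show "(?N (\<lambda>x. Ls z_ss x - t x))\<^sup>2 \<le> (?N (\<lambda>x. Ls w x - t x))\<^sup>2"
      using weight by simp
  qed
  have project_Z: "?N (\<lambda>x. Ls z_ss x - u_hat x)
      \<le> ?N (\<lambda>x. u_ss x - u_hat x) / (\<omega> + 1) + ?N (\<lambda>x. Ls w x - u_hat x)" if w: "w \<in> Z" for w
    unfolding t_dist[symmetric]
  proof (rule best_approximation_dist_le[OF Z_L2[OF ss(2)] t_L2 hat Z_L2[OF w]])
    fix \<tau> :: real
    have comb: "(\<lambda>x. (1 - \<tau>) * z_ss x + \<tau> * w x) \<in> Z"
      using finite_dim_space_linear[OF Z(1) ss(2) w] .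
    have zD: "z_ss \<in> adjoint_domain \<Omega> D L" and wD: "w \<in> adjoint_domain \<Omega> D L"
      and combD: "(\<lambda>x. (1 - \<tau>) * z_ss x + \<tau> * w x) \<in> adjoint_domain \<Omega> D L"
      using Z(2) ss(2) w comb by (auto simp: adjoint(1))
    \<comment> \<open>\<open>z_min\<close> concerns the image of the combination in
      \<open>Z\<close>, the goal the combination of the images; these have the same distance to
      \<open>t\<close>.\<close>
    show "?N (\<lambda>x. Ls z_ss x - t x) \<le> ?N (\<lambda>x. (1 - \<tau>) * Ls z_ss x + \<tau> * Ls w x - t x)"
      using z_min[OF comb] adjoint_op_dist_linear[OF dense D_L2 L_L2 zD wD combD t_L2]
      by (simp add: adjoint(2))
  qed
  have bound_ss: "?N (\<lambda>x. u_ss x - u_hat x)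
      \<le> (\<omega> + 1) / \<omega> * (?N (\<lambda>x. v x - u_hat x) + ?N (\<lambda>x. Ls w x - u_hat x))"
    if "v \<in> U" "w \<in> Z" for v w
  proof -
    \<comment> \<open>Now the second component is kept at \<open>z_ss\<close>, and the weighted term
      cancels.\<close>
    have "?N (\<lambda>x. u_ss x - Ls z_ss x) \<le> ?N (\<lambda>x. v x - Ls z_ss x)" if "v \<in> U" for v
      using ss_min[OF that ss(2)] by (intro power2_le_imp_le[OF _ l2_norm_nonneg]) simp
    note project_U[OF ss \<open>v \<in> U\<close> this] project_Z[OF \<open>w \<in> Z\<close>]
    \<comment> \<open>Absorption: the left side is \<open>\<omega> / (\<omega> + 1)\<close> times
      the error, and the reciprocal is the value of \<open>s\<close> for the single-stage
      method.\<close>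
    then have "?N (\<lambda>x. u_ss x - u_hat x) - ?N (\<lambda>x. u_ss x - u_hat x) / (\<omega> + 1)
        \<le> ?N (\<lambda>x. v x - u_hat x) + ?N (\<lambda>x. Ls w x - u_hat x)"
      by simp
    then show ?thesis using weight by (simp add: field_simps)
  qed
  have "s > 0" using choice weight by auto
  have "?N (\<lambda>x. u_h x - u_hat x)
      \<le> s * ?N (\<lambda>x. v x - u_hat x) + (s + 1) * ?N (\<lambda>x. Ls w x - u_hat x)"
    if v: "v \<in> U" and w: "w \<in> Z" for v w
  proof -
    have "?N (\<lambda>x. u_h x - u_hat x) \<le> s * (?N (\<lambda>x. v x - u_hat x) + ?N (\<lambda>x. Ls w x - u_hat x))"
      using choice bound_ss[OF v w] project_U[OF ts(2,1) v ts_min(2)] ts_min(1)[OF w] by auto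
    \<comment> \<open>The passage from \<open>s\<close> to \<open>s + 1\<close> only adds a
      nonnegative term.\<close>
    also have "\<dots> \<le> s * ?N (\<lambda>x. v x - u_hat x) + (s + 1) * ?N (\<lambda>x. Ls w x - u_hat x)"
      using l2_norm_nonneg by (simp add: algebra_simps)
    finally show ?thesis .
  qed
  \<comment> \<open>The two-stage minimisers in \<open>ts\<close> witness that \<open>U\<close> and
    \<open>Z\<close> are nonempty.\<close>
  then show ?thesis
    using ts \<open>s > 0\<close> by (intro le_weighted_INF_add) auto
qed

end
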